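(* Let $\mathbb{K}\in\{\mathbb{R},\mathbb{C}\}$, let $L$ be a compact Hausdorff space, let $\rho\subseteq L\times L$ be a closed equivalence relation on $L$, and let $R$ be a set of representatives of $\rho$ such that there is an infinite closed subset $S\subseteq(L\times R)\cap\rho$ with $sw(S)>sw(S\cap D_L)$. Put $$\kappa_0:=\big|\{f\in\mathcal{C}_L(\rho,\mathbb{K}):f|_S\equiv 0\}\big|.$$ Then $\mathcal{C}(L,\mathbb{K})\setminus\mathcal{C}_\rho(L,\mathbb{K})$ is $(sw(S)+\kappa_0)$-lineable but not $(sw(S)+\kappa_0)^{+}$-lineable.
   Context: For a compact Hausdorff space $X$, $\mathcal{C}(X,\mathbb{K})$ is the Banach space of continuous functions $X\to\mathbb{K}$ with the sup-norm, and its Stone-Weierstrass character is $sw(X):=\dim(\mathcal{C}(X,\mathbb{K}))$ (algebraic dimension over $\mathbb{K}$; the value is the same for $\mathbb{K}=\mathbb{R}$ and $\mathbb{K}=\mathbb{C}$). $D_L=\{(x,x):x\in L\}$ is the diagonal. The map $\Delta_\rho:\mathcal{C}(L,\mathbb{K})\to\mathcal{C}(\rho,\mathbb{K})$ is $\Delta_\rho(f)(x,y)=f(x)-f(y)$ for $(x,y)\in\rho$. Define $\mathcal{C}_\rho(L,\mathbb{K}):=\mathrm{Ker}(\Delta_\rho)=\{f\in\mathcal{C}(L,\mathbb{K}): x\,\rho\, y\Rightarrow f(x)=f(y)\}$ and $\mathcal{C}_L(\rho,\mathbb{K}):=\mathrm{Im}(\Delta_\rho)$. A set of representatives of $\rho$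 is a subset $R\subseteq L$ containing exactly one element of each equivalence class. $|\cdot|$ is cardinality and $\kappa^{+}$ is the least cardinal greater than $\kappa$. A subset $M$ of a vector space $V$ is $\kappa$-lineable if $M\cup\{0\}$ contains a vector subspace of $V$ of (algebraic) dimension $\kappa$ over $\mathbb{K}$. *)

theory Defs
  imports "HOL-Analysis.Analysis" "HOL-Library.Function_Algebras"
begin

unbundle cardinal_syntax

global_interpretation fun_space: vector_space "\<lambda>(c::'k::field) (f::'a \<Rightarrow> 'k) x. c * f x"
  by unfold_locales (auto simp: fun_eq_iff algebra_simps)

(* Algebraic dimension as a cardinal, in the style of the library's nat-valued dim (which is
   useless for infinite-dimensional spaces). Only determined up to =o. *)
definition cdim :: "('a \<Rightarrow> 'k::field) set \<Rightarrow> ('a \<Rightarrow> 'k) rel"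
  where "cdim V = |SOME B. fun_space.independent B \<and> fun_space.span B = fun_space.span V|"

definition lineable :: "('a \<Rightarrow> 'k::field) set \<Rightarrow> 'c rel \<Rightarrow> bool"
  where "lineable M \<kappa> \<longleftrightarrow> (\<exists>W. fun_space.subspace W \<and> W \<subseteq> M \<union> {0} \<and> cdim W =o \<kappa>)"

(* In the following, the scalar field is passed as a type argument; it is meant to be real or
   complex. Functions on topspace X are represented by total functions that are 0 outside
   topspace X, so that distinct elements of cfun differ on topspace X and cfun is a subspace of
   the ambient function space. *)
definition cfun :: "'k::real_normed_field itself \<Rightarrow> 'a topology \<Rightarrow> ('a \<Rightarrow> 'k) set"
  where "cfun _ X = {f. continuous_map X euclidean f \<and> (\<forall>x. x \<notin> topspace X \<longrightarrow> f x = 0)}"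

definition sw :: "'k::real_normed_field itself \<Rightarrow> 'a topology \<Rightarrow> ('a \<Rightarrow> 'k) rel"
  where "sw K X = cdim (cfun K X)"

definition Delta :: "('a \<times> 'a) set \<Rightarrow> ('a \<Rightarrow> 'k::real_normed_field) \<Rightarrow> 'a \<times> 'a \<Rightarrow> 'k"
  where "Delta \<rho> f = (\<lambda>(x, y). if (x, y) \<in> \<rho> then f x - f y else 0)"

definition ker_Delta ::
    "'k::real_normed_field itself \<Rightarrow> 'a topology \<Rightarrow> ('a \<times> 'a) set \<Rightarrow> ('a \<Rightarrow> 'k) set"
  where "ker_Delta K L \<rho> = {f \<in> cfun K L. Delta \<rho> f = 0}"

definition im_Delta ::
    "'k::real_normed_field itself \<Rightarrow> 'a topology \<Rightarrow> ('a \<times> 'a) set \<Rightarrow> ('a \<times> 'a \<Rightarrow> 'k) set"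
  where "im_Delta K L \<rho> = Delta \<rho> ` cfun K L"

definition representatives :: "'a topology \<Rightarrow> ('a \<times> 'a) set \<Rightarrow> 'a set \<Rightarrow> bool"
  where "representatives L \<rho> R \<longleftrightarrow>
    R \<subseteq> topspace L \<and> (\<forall>C \<in> topspace L // \<rho>. \<exists>!x. x \<in> R \<inter> C)"

lemma ker_Delta_iff:
  "f \<in> ker_Delta K L \<rho> \<longleftrightarrow> f \<in> cfun K L \<and> (\<forall>x y. (x, y) \<in> \<rho> \<longrightarrow> f x = f y)"
  by (auto simp: ker_Delta_def Delta_def fun_eq_iff)

lemma continuous_map_scale:
  fixes f :: "'a \<Rightarrow> 'k::real_normed_field"
  assumes "continuous_map X euclidean f"
  shows "continuous_map X euclidean (\<lambda>x. c * f x)"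
proof -
  have "continuous_map euclidean euclidean (\<lambda>y. c * y)"
    by (auto intro!: continuous_intros)
  from continuous_map_compose[OF assms this] show ?thesis
    by (simp add: o_def)
qed

lemma subspace_cfun: "fun_space.subspace (cfun K X)"
  by (auto simp: fun_space.subspace_def cfun_def plus_fun_def zero_fun_def
      intro!: continuous_intros continuous_map_scale)

lemma im_Delta_subset_cfun:
  assumes "\<rho> \<subseteq> topspace L \<times> topspace L"
  shows "im_Delta K L \<rho> \<subseteq> cfun K (subtopology (prod_topology L L) \<rho>)"
proof
  fix g assume "g \<in> im_Delta K L \<rho>"
  then obtain f where f: "f \<in> cfun K L" and g: "g = Delta \<rho> f"
    by (auto simp: im_Delta_def)
  have "continuous_map (prod_topology L L) euclidean (f \<circ> fst)"
       "continuous_map (prod_topology L L) euclidean (f \<circ> snd)"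
    using f by (auto simp: cfun_def intro: continuous_map_compose continuous_map_fst continuous_map_snd)
  then have "continuous_map (prod_topology L L) euclidean (\<lambda>p. f (fst p) - f (snd p))"
    by (auto simp: o_def intro!: continuous_intros)
  then have "continuous_map (subtopology (prod_topology L L) \<rho>) euclidean (\<lambda>p. f (fst p) - f (snd p))"
    by (rule continuous_map_from_subtopology)
  then have "continuous_map (subtopology (prod_topology L L) \<rho>) euclidean g"
    by (rule continuous_map_eq) (auto simp: g Delta_def)
  then show "g \<in> cfun K (subtopology (prod_topology L L) \<rho>)"
    using assms by (auto simp: cfun_def g Delta_def)
qed

end

theory Submission
  imports Defs
begin

text \<open>
  The functions to be found live outside the kernel of the linear map \<^const>\<open>Delta\<close>. A subspace
  meets that kernel only in \<open>0\<close> exactly when \<^const>\<open>Delta\<close> is injective on it, so the largest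
  dimension of such a subspace is the dimension of the image of \<^const>\<open>Delta\<close>, and it is attained by any
  complement of the kernel (\<open>lineable_complement_of_kernel\<close>). Everything comes down to showing that
  this image has dimension \<open>sw(S) + \<kappa>\<^sub>0\<close> (\<open>cdim_im_Delta\<close>).

  The image is split by restriction to \<open>S\<close>. The functions that restrict to \<open>0\<close> form the space \<open>N\<close>
  with \<open>|N| = \<kappa>\<^sub>0\<close>. The restrictions are precisely the continuous functions on \<open>S\<close> that vanish on the
  diagonal (\<open>restrict0_im_Delta\<close>): as the second coordinate of a point of \<open>S\<close> is a representative,
  the first coordinate determines the point, and a function on \<open>S\<close> can be turned into a function
  on \<open>L\<close> by Tietze's theorem. Restricting from \<open>S\<close> to its diagonal part, the dimension formula
  writes \<open>sw(S)\<close> as the dimension of that function space plus \<open>sw\<close> of the diagonal part; the latter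
  is strictly smaller than the infinite cardinal \<open>sw(S)\<close>, so the former equals \<open>sw(S)\<close>.

  It remains to replace the dimension of \<open>N\<close> by its cardinality. The two differ by no more than the
  cardinality of the continuum (\<open>card_of_subspace_ordLeq\<close>), and \<open>sw(S)\<close> is at least the continuum
  for every infinite compact Hausdorff space (\<open>continuum_ordLeq_sw\<close>): such a space carries a continuous
  function \<open>F \<ge> 0\<close> with infinite range, and then the functions \<open>1 / (F + t)\<close> with \<open>t > 0\<close> are
  linearly independent.
\<close>

section \<open>Dimension as a cardinal\<close>

abbreviation linear_map :: "(('a \<Rightarrow> 'k::field) \<Rightarrow> ('b \<Rightarrow> 'k)) \<Rightarrow> bool"
  where "linear_map T \<equiv> Vector_Spaces.linear (\<lambda>c f x. c * f x) (\<lambda>c f x. c * f x) T"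

interpretation fun_pair: vector_space_pair
  "\<lambda>(c::'k::field) (f::'a \<Rightarrow> 'k) x. c * f x" "\<lambda>(c::'k) (f::'b \<Rightarrow> 'k) x. c * f x"
  by unfold_locales

lemma linear_mapI:
  assumes "\<And>f g. T (f + g) = T f + T g" and "\<And>c f. T (\<lambda>x. c * f x) = (\<lambda>y. c * T f y)"
  shows "linear_map T"
  using assms by (simp add: Vector_Spaces.linear_iff fun_space.vector_space_axioms)

lemma Card_order_cdim: "Card_order (cdim V)"
  by (simp add: cdim_def card_of_Card_order)

text \<open>Any two bases of the same space are in bijection, so the basis picked by the choice
  operator in the definition of \<^const>\<open>cdim\<close> can be traded for whichever basis is convenient.\<close>

lemma cdim_eq_card_of_basis:
  assumes "fun_space.independent B" and "fun_space.span B = fun_space.span V"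
  shows "cdim V =o |B|"
proof -
  define C where "C = (SOME B. fun_space.independent B \<and> fun_space.span B = fun_space.span V)"
  have "fun_space.independent C \<and> fun_space.span C = fun_space.span V"
    unfolding C_def by (rule someI[where x = B]) (use assms in simp)
  then obtain f where "bij_betw f C B"
    using fun_space.bij_if_span_eq_span_bases[of C B] assms by auto
  then show ?thesis
    unfolding cdim_def C_def[symmetric] using card_of_ordIso by blast
qed

lemma basis_of_subspace:
  assumes "fun_space.subspace V"
  obtains B where "B \<subseteq> V" "fun_space.independent B" "fun_space.span B = V" "cdim V =o |B|"
proof -
  obtain B where B: "B \<subseteq> V" "fun_space.independent B" "V \<subseteq> fun_space.span B"
    using fun_space.maximal_independent_subset .
  then have "fun_space.span B = V"
    using assms fun_space.span_minimal by blast
  moreover from this have "cdim V =o |B|"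
    by (intro cdim_eq_card_of_basis B(2)) (metis fun_space.span_eq_iff[THEN iffD2, OF assms])
  ultimately show thesis using that B by blast
qed

lemma independent_ordLeq_cdim:
  assumes "fun_space.subspace V" and "B \<subseteq> V" and "fun_space.independent B"
  shows "|B| \<le>o cdim V"
proof -
  obtain C where C: "B \<subseteq> C" "C \<subseteq> V" "fun_space.independent C" "V \<subseteq> fun_space.span C"
    by (rule fun_space.maximal_independent_subset_extend[OF assms(2,3)])
  have "fun_space.span C = fun_space.span V"
    unfolding fun_space.span_eq using C(2,4) fun_space.span_superset by (blast intro: order_trans)
  then have "cdim V =o |C|"
    by (rule cdim_eq_card_of_basis[OF C(3)])
  then show ?thesis
    using ordLeq_ordIso_trans[OF card_of_mono1[OF C(1)] ordIso_symmetric] by blast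
qed

lemma cdim_mono:
  assumes "fun_space.subspace U" and "fun_space.subspace V" and "U \<subseteq> V"
  shows "cdim U \<le>o cdim V"
proof -
  obtain B where B: "B \<subseteq> U" "fun_space.independent B" "cdim U =o |B|"
    using basis_of_subspace[OF assms(1)] .
  then have "|B| \<le>o cdim V"
    using assms by (intro independent_ordLeq_cdim) auto
  with B(3) show ?thesis by (rule ordIso_ordLeq_trans)
qed

lemma cdim_ordLeq_card_of:
  assumes "fun_space.subspace V" 
  shows "cdim V \<le>o |V|"
proof -
  obtain B where B: "B \<subseteq> V" "cdim V =o |B|"
    using basis_of_subspace[OF assms] .
  show ?thesis
    using ordIso_ordLeq_trans[OF B(2) card_of_mono1[OF B(1)]] .
qed

lemma subspace_linear_image:
  assumes "linear_map T" and "fun_space.subspace V"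
  shows "fun_space.subspace (T ` V)"
  using assms fun_pair.linear_subspace_image by blast

lemma cdim_linear_image_inj:
  fixes T :: "('a \<Rightarrow> 'k::field) \<Rightarrow> ('b \<Rightarrow> 'k)"
  assumes T: "linear_map T" and W: "fun_space.subspace W" 
    and inj: "\<And>f. f \<in> W \<Longrightarrow> T f = 0 \<Longrightarrow> f = 0"
  shows "cdim (T ` W) =o cdim W"
proof -
  obtain B where B: "B \<subseteq> W" "fun_space.independent B" "fun_space.span B = W" "cdim W =o |B|"
    using basis_of_subspace[OF W] .
  have inj_on: "inj_on T W"
    using fun_pair.linear_inj_on_iff_eq_0[OF T W] inj by blast
  have "fun_space.independent (T ` B)"
    using fun_pair.linear_independent_injective_image[OF T B(2)] inj_on B(3) by simp
  moreover have "fun_space.span (T ` B) = fun_space.span (T ` W)"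
    unfolding fun_pair.linear_span_image[OF T] B(3) fun_space.span_eq_iff[THEN iffD2, OF W] ..
  ultimately have "cdim (T ` W) =o |T ` B|"
    by (rule cdim_eq_card_of_basis)
  also have "|T ` B| =o |B|"
    using card_of_ordIsoI[OF inj_on_imp_bij_betw[OF inj_on_subset[OF inj_on B(1)]]]
    by (rule ordIso_symmetric)
  also have "|B| =o cdim W"
    using B(4) by (rule ordIso_symmetric)
  finally show ?thesis .
qed

text \<open>Extend a basis \<open>A\<close> of the kernel to a basis \<open>B\<close> of \<open>V\<close>; the complement is the span
  of \<open>B - A\<close>. It carries all of \<open>T\<close> without collapsing anything, so it is at the same time the
  source of the dimension formula and the witness for lineability.\<close>

lemma complement_of_kernel:
  fixes T :: "('a \<Rightarrow> 'k::field) \<Rightarrow> ('b \<Rightarrow> 'k)"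
  assumes T: "linear_map T" and V: "fun_space.subspace V"
  obtains W where "fun_space.subspace W" "W \<subseteq> V" "\<And>f. f \<in> W \<Longrightarrow> T f = 0 \<Longrightarrow> f = 0"
    "T ` W = T ` V" "cdim V =o cdim {f \<in> V. T f = 0} +c cdim W"
proof -
  define K where "K = {f \<in> V. T f = 0}"
  have subK: "fun_space.subspace K"
    using fun_space.subspace_inter[OF V fun_pair.linear_subspace_kernel[OF T]]
    by (simp add: K_def Int_def)
  obtain A where A: "A \<subseteq> K" "fun_space.independent A" "fun_space.span A = K" "cdim K =o |A|"
    using basis_of_subspace[OF subK] .
  have "A \<subseteq> V" using A(1) by (auto simp: K_def)
  then obtain B where B: "A \<subseteq> B" "B \<subseteq> V" "fun_space.independent B" "V \<subseteq> fun_space.span B"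
    by (rule fun_space.maximal_independent_subset_extend[OF _ A(2)])
  have span_B: "fun_space.span B = V"
    using B V fun_space.span_minimal by blast
  define W where "W = fun_space.span (B - A)"
  have subW: "fun_space.subspace W" by (simp add: W_def)
  have "W \<subseteq> V"
    unfolding W_def span_B[symmetric] by (intro fun_space.span_mono) auto
  have indep: "fun_space.independent (B - A)"
    using B(3) fun_space.independent_mono by blast
  have disj: "f = 0" if f: "f \<in> W" "T f = 0" for f
  proof -
    have fA: "f \<in> fun_space.span A" and fB: "f \<in> fun_space.span B"
      using f \<open>W \<subseteq> V\<close> A(3) span_B by (auto simp: K_def)
    \<comment> \<open>The coordinates of \<open>f\<close> with respect to \<open>B\<close> are supported both in \<open>A\<close> and in \<open>B - A\<close>.\<close>
    have "fun_space.representation B f = fun_space.representation A f"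
      by (rule fun_space.representation_extend[OF B(3) fA B(1)])
    moreover have "fun_space.representation B f = fun_space.representation (B - A) f"
      using f(1) by (intro fun_space.representation_extend[OF B(3)]) (auto simp: W_def)
    ultimately have "fun_space.representation B f b = 0" for b
      using fun_space.representation_ne_zero[of A f b] fun_space.representation_ne_zero[of "B - A" f b]
      by auto
    then show "f = 0"
      using fun_space.sum_nonzero_representation_eq[OF B(3) fB] by simp
  qed
  have "T ` W = T ` V"
  proof
    show "T ` V \<subseteq> T ` W"
    proof
      fix g assume "g \<in> T ` V"
      then obtain f where f: "f \<in> V" "g = T f" by blast
      have "V = fun_space.span (A \<union> (B - A))"
        using B(1) span_B by (simp add: Un_absorb1)
      then obtain a b where ab: "a \<in> fun_space.span A" "b \<in> W" "f = a + b"
        using f(1) unfolding fun_space.span_Un W_def by blast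
      then have "T a = 0" using A(3) by (simp add: K_def)
      then have "T f = T b" using ab(3) fun_pair.linear_add[OF T] by simp
      then show "g \<in> T ` W" using f(2) ab(2) by blast
    qed
  qed (use \<open>W \<subseteq> V\<close> in blast)
  moreover have "cdim V =o cdim K +c cdim W"
  proof -
    have "cdim V =o |B|"
      by (intro cdim_eq_card_of_basis B(3)) (metis span_B fun_space.span_eq_iff[THEN iffD2, OF V])
    also have "|B| =o |A <+> (B - A)|"
    proof (rule card_of_ordIsoI)
      show "bij_betw (\<lambda>b. if b \<in> A then Inl b else Inr b) B (A <+> (B - A))"
        using B(1) by (auto simp: bij_betw_def inj_on_def split: if_splits)
    qed
    also have "|A <+> (B - A)| =o |A| +c |B - A|"
      by (rule Plus_csum)
    also have "|A| +c |B - A| =o cdim K +c cdim W"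
    proof (rule csum_cong)
      show "|A| =o cdim K" using A(4) by (rule ordIso_symmetric)
      show "|B - A| =o cdim W"
        unfolding W_def
        by (rule ordIso_symmetric[OF cdim_eq_card_of_basis[OF indep fun_space.span_span[symmetric]]])
    qed
    finally show ?thesis .
  qed
  ultimately show thesis
    using that[OF subW \<open>W \<subseteq> V\<close> disj] by (simp add: K_def)
qed

lemma rank_nullity:
  fixes T :: "('a \<Rightarrow> 'k::field) \<Rightarrow> ('b \<Rightarrow> 'k)"
  assumes T: "linear_map T" and V: "fun_space.subspace V"
  shows "cdim V =o cdim {f \<in> V. T f = 0} +c cdim (T ` V)"
proof -
  obtain W where W: "fun_space.subspace W" "W \<subseteq> V" "\<And>f. f \<in> W \<Longrightarrow> T f = 0 \<Longrightarrow> f = 0"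
    "T ` W = T ` V" "cdim V =o cdim {f \<in> V. T f = 0} +c cdim W"
    by (rule complement_of_kernel[OF T V]) blast
  have "cdim W =o cdim (T ` V)"
    using ordIso_symmetric[OF cdim_linear_image_inj[OF T W(1,3)]] W(4) by simp
  then show ?thesis
    by (rule ordIso_transitive[OF W(5) csum_cong2])
qed

text \<open>A subspace of \<open>V\<close> that avoids the nonzero elements of the kernel is mapped
  injectively by \<open>T\<close>, so its dimension is at most that of the image; a complement of the kernel attains
  this bound. The lineability question is thereby reduced to the dimension of the image.\<close>

lemma lineable_complement_of_kernel:
  fixes T :: "('a \<Rightarrow> 'k::field) \<Rightarrow> ('b \<Rightarrow> 'k)" and \<kappa> :: "'c rel"
  assumes T: "linear_map T" and V: "fun_space.subspace V"
    and \<kappa>: "Card_order \<kappa>" "cdim (T ` V) =o \<kappa>"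
  shows "lineable (V - {f \<in> V. T f = 0}) \<kappa>"
    and "\<not> lineable (V - {f \<in> V. T f = 0}) (cardSuc \<kappa>)"
proof -
  obtain W where W: "fun_space.subspace W" "W \<subseteq> V" "\<And>f. f \<in> W \<Longrightarrow> T f = 0 \<Longrightarrow> f = 0"
    "T ` W = T ` V" "cdim V =o cdim {f \<in> V. T f = 0} +c cdim W"
    by (rule complement_of_kernel[OF T V]) blast
  have "cdim W =o \<kappa>"
    using ordIso_transitive[OF ordIso_symmetric[OF cdim_linear_image_inj[OF T W(1,3)]]] W(4) \<kappa>(2)
    by simp
  then show "lineable (V - {f \<in> V. T f = 0}) \<kappa>"
    unfolding lineable_def using W by blast
  show "\<not> lineable (V - {f \<in> V. T f = 0}) (cardSuc \<kappa>)"
  proof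
    assume "lineable (V - {f \<in> V. T f = 0}) (cardSuc \<kappa>)"
    then obtain U where U: "fun_space.subspace U" "U \<subseteq> (V - {f \<in> V. T f = 0}) \<union> {0}"
      "cdim U =o cardSuc \<kappa>"
      unfolding lineable_def by blast
    have "U \<subseteq> V" using U(2) fun_space.subspace_0[OF V] by auto
    have "cardSuc \<kappa> =o cdim U" using U(3) by (rule ordIso_symmetric)
    also have "cdim U =o cdim (T ` U)"
      by (rule ordIso_symmetric[OF cdim_linear_image_inj[OF T U(1)]]) (use U(2) in auto)
    also have "cdim (T ` U) \<le>o cdim (T ` V)"
      using U(1) V T \<open>U \<subseteq> V\<close> by (intro cdim_mono subspace_linear_image image_mono)
    also have "cdim (T ` V) =o \<kappa>" by (rule \<kappa>(2))
    finally show False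
      using cardSuc_greater[OF \<kappa>(1)] not_ordLess_ordLeq by blast
  qed
qed

text \<open>Every element is reached from \<open>0\<close> by finitely many steps \<open>f \<mapsto> c b + f\<close> with a scalar
  \<open>c\<close> and a basis vector \<open>b\<close>. The set \<open>E n\<close> of what is reached in \<open>n\<close> steps has at most \<open>r\<close> elements,
  and \<open>V\<close> is a countable union of such sets. This is what allows the cardinality in the definition of
  \<open>\<kappa>\<^sub>0\<close> to be replaced by a dimension.\<close>

lemma card_of_subspace_ordLeq:
  fixes V :: "('a \<Rightarrow> 'k::field) set" and r :: "'c rel"
  assumes V: "fun_space.subspace V" and r: "Cinfinite r"
    and dim: "cdim V \<le>o r" and scalars: "|UNIV :: 'k set| \<le>o r"
  shows "|V| \<le>o r"
proof -
  obtain B where "B \<subseteq> V" "fun_space.independent B" and B: "fun_space.span B = V" "cdim V =o |B|"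
    by (rule basis_of_subspace[OF V])
  define step where "step = (\<lambda>((c, b), f). (\<lambda>x. c * b x) + f :: 'a \<Rightarrow> 'k)"
  define E where "E n = ((\<lambda>F. step ` ((UNIV \<times> B) \<times> F)) ^^ n) {0}" for n
  have E_0: "E 0 = {0}" and E_Suc: "E (Suc n) = step ` ((UNIV \<times> B) \<times> E n)" for n
    by (simp_all add: E_def)
  have inf: "infinite (Field r)" and card: "Card_order r"
    using r by (auto simp: cinfinite_def)
  have "|B| \<le>o r"
    using ordIso_ordLeq_trans[OF ordIso_symmetric[OF B(2)] dim] .
  then have BK: "|(UNIV :: 'k set) \<times> B| \<le>o r"
    using card_of_Times_ordLeq_infinite_Field[OF inf scalars _ card] by blast
  have E: "|E n| \<le>o r" for n
  proof (induction n)
    case 0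
    obtain y where "y \<in> Field r" using inf by fastforce
    then have "|{0 :: 'a \<Rightarrow> 'k}| \<le>o |Field r|"
      by (intro card_of_ordLeqI[where f = "\<lambda>_. y"]) auto
    then show ?case
      unfolding E_0 by (rule ordLeq_ordIso_trans[OF _ card_of_Field_ordIso[OF card]])
  next
    case (Suc n)
    have "|E (Suc n)| \<le>o |((UNIV :: 'k set) \<times> B) \<times> E n|"
      unfolding E_Suc by (rule card_of_image)
    also have "|((UNIV :: 'k set) \<times> B) \<times> E n| \<le>o r"
      using card_of_Times_ordLeq_infinite_Field[OF inf BK Suc card] .
    finally show ?case .
  qed
  have "V \<subseteq> (\<Union>n. E n)"
  proof
    fix f assume "f \<in> V"
    then have "f \<in> fun_space.span B" by (simp add: B(1))
    then show "f \<in> (\<Union>n. E n)"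
    proof (induction rule: fun_space.span_induct_alt)
      case base
      then show ?case using E_0 by blast
    next
      case (step c b g)
      then obtain n where "g \<in> E n" by blast
      then have "step ((c, b), g) \<in> E (Suc n)"
        using step(1) unfolding E_Suc by blast
      then show ?case unfolding step_def case_prod_conv by blast
    qed
  qed
  then have "|V| \<le>o |\<Union>n. E n|"
    by (rule card_of_mono1)
  also have "|\<Union>n. E n| \<le>o r"
  proof (rule card_of_UNION_ordLeq_infinite_Field[OF inf card])
    show "|UNIV :: nat set| \<le>o r"
      using inf ordLeq_ordIso_trans[OF _ card_of_Field_ordIso[OF card]]
      by (simp add: infinite_iff_card_of_nat)
  qed (use E in blast)
  finally show ?thesis .
qed

section \<open>Restriction and extension of continuous functions\<close>

text \<open>Tietze's theorem is applied to each coordinate separately; with \<open>'b\<close> the real or the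
  complex numbers this covers both scalar fields at once.\<close>

lemma Tietze_extension_euclidean_space:
  fixes h :: "'a \<Rightarrow> 'b::euclidean_space"
  assumes "normal_space X" and "closedin X A" and h: "continuous_map (subtopology X A) euclidean h"
  obtains g where "continuous_map X euclidean g" "\<And>x. x \<in> A \<Longrightarrow> g x = h x"
proof -
  have "\<exists>g. continuous_map X euclideanreal g \<and> (\<forall>x\<in>A. g x = h x \<bullet> b)" for b
  proof -
    have "continuous_map euclidean euclideanreal (\<lambda>y::'b. y \<bullet> b)"
      by (auto intro!: continuous_intros)
    from continuous_map_compose[OF h this]
    have "continuous_map (subtopology X A) euclideanreal (\<lambda>x. h x \<bullet> b)"
      by (simp add: o_def)
    then show ?thesis
      using assms normal_space_iff_Tietze by blast
  qed
  then obtain g where g: "\<And>b. continuous_map X euclideanreal (g b)"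
    "\<And>b x. x \<in> A \<Longrightarrow> g b x = h x \<bullet> b"
    by metis
  have "continuous_map X euclidean (\<lambda>x. g b x *\<^sub>R b)" for b
  proof -
    have "continuous_map euclideanreal euclidean (\<lambda>t. t *\<^sub>R b)"
      by (auto intro!: continuous_intros)
    from continuous_map_compose[OF g(1)[of b] this] show ?thesis by (simp add: o_def)
  qed
  then have "continuous_map X euclidean (\<lambda>x. \<Sum>b\<in>Basis. g b x *\<^sub>R b)"
    by (intro continuous_map_sum) auto
  moreover have "(\<Sum>b\<in>Basis. g b x *\<^sub>R b) = h x" if "x \<in> A" for x
    using g(2)[OF that] by (simp add: euclidean_representation)
  ultimately show thesis using that by blast
qed

text \<open>Elements of \<^const>\<open>cfun\<close> vanish off the underlying space, so restricting to a subspace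
  has to set the values outside it to \<open>0\<close>.\<close>

definition restrict0 :: "'a set \<Rightarrow> ('a \<Rightarrow> 'b) \<Rightarrow> 'a \<Rightarrow> 'b::zero"
  where "restrict0 A f = (\<lambda>x. if x \<in> A then f x else 0)"

lemma restrict0_eq_0_iff: "restrict0 A f = 0 \<longleftrightarrow> (\<forall>x\<in>A. f x = 0)"
  by (auto simp: restrict0_def fun_eq_iff)

lemma restrict0_in_cfun:
  assumes "A \<subseteq> topspace X" and "continuous_map X euclidean f"
  shows "restrict0 A f \<in> cfun K (subtopology X A)"
proof -
  have "continuous_map (subtopology X A) euclidean (restrict0 A f)"
    using continuous_map_from_subtopology[OF assms(2)]
    by (rule continuous_map_eq) (auto simp: restrict0_def)
  then show ?thesis
    using assms(1) by (auto simp: cfun_def restrict0_def)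
qed

text \<open>Restriction to a closed subspace is onto, by Tietze's theorem. Together with
  \<^const>\<open>sw\<close> being a dimension, this makes the dimension formula applicable to restriction maps.\<close>

lemma restrict0_cfun:
  fixes K :: "'k::{real_normed_field,euclidean_space} itself"
  assumes "normal_space X" and "closedin X A"
  shows "restrict0 A ` cfun K X = cfun K (subtopology X A)"
proof
  show "restrict0 A ` cfun K X \<subseteq> cfun K (subtopology X A)"
    using restrict0_in_cfun closedin_subset[OF assms(2)] by (fastforce simp: cfun_def)
  show "cfun K (subtopology X A) \<subseteq> restrict0 A ` cfun K X"
  proof
    fix h assume h: "h \<in> cfun K (subtopology X A)"
    then obtain g where g: "continuous_map X euclidean g" "\<And>x. x \<in> A \<Longrightarrow> g x = h x"
      using Tietze_extension_euclidean_space[OF assms] by (auto simp: cfun_def)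
    define f where "f = restrict0 (topspace X) g"
    have "f \<in> cfun K X"
      using restrict0_in_cfun[OF order_refl g(1)] by (simp add: f_def)
    moreover have "h = restrict0 A f"
      using g(2) h closedin_subset[OF assms(2)]
      by (fastforce simp: f_def restrict0_def cfun_def fun_eq_iff)
    ultimately show "h \<in> restrict0 A ` cfun K X" by blast
  qed
qed

section \<open>Infinite compact spaces have many continuous functions\<close>

text \<open>By compactness there is a point \<open>z\<close> that is not isolated. A series of bumps, each vanishing at
  \<open>z\<close> and the \<open>n\<close>-th one scaled by \<open>(1/2)^n\<close>, converges uniformly. If the \<open>n\<close>-th bump is placed at a point
  so close to \<open>z\<close> that the preceding partial sum is already below \<open>(1/2)^n\<close> there, the sum \<open>F\<close> takes
  a positive value at this point, but one of order \<open>(1/2)^n\<close>. Having arbitrarily small positive values, \<open>F\<close>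
  has infinite range.\<close>

lemma ex_continuous_map_infinite_range:
  fixes X :: "'a topology"
  assumes X: "compact_space X" "Hausdorff_space X" "infinite (topspace X)"
  obtains F where "continuous_map X euclideanreal F" "\<And>x. x \<in> topspace X \<Longrightarrow> F x \<ge> 0"
    "infinite (F ` topspace X)"
proof -
  have "X derived_set_of topspace X \<noteq> {}"
    using X compact_space_discrete_topology discrete_topology_unique_derived_set by metis
  then obtain z where "z \<in> X derived_set_of topspace X" by blast
  then have z: "z \<in> topspace X"
    and accum: "\<And>U. openin X U \<Longrightarrow> z \<in> U \<Longrightarrow> \<exists>x\<in>U. x \<in> topspace X \<and> x \<noteq> z"
    by (auto simp: in_derived_set_of)
  have normal: "normal_space X"
    using X compact_Hausdorff_or_regular_imp_normal_space by blast
  have bump: "\<exists>f. continuous_map X euclideanreal f \<and> (\<forall>y\<in>topspace X. 0 \<le> f y \<and> f y \<le> 1)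
      \<and> f z = 0 \<and> f x = 1" if x: "x \<in> topspace X" "x \<noteq> z" for x
  proof -
    have "closedin X {z}" "closedin X {x}"
      using X(2) x z by (simp_all add: closedin_Hausdorff_singleton)
    then obtain f where "continuous_map X (top_of_set {0..1::real}) f" "f ` {z} \<subseteq> {0}" "f ` {x} \<subseteq> {1}"
      using Urysohn_lemma[OF normal, of "{z}" "{x}" 0 1] x(2) by (auto simp: disjnt_def)
    then show ?thesis
      by (intro exI[of _ f]) (auto simp: continuous_map_in_subtopology)
  qed
  \<comment> \<open>Partial sums are built one at a time: \<open>P\<close> is the invariant, \<open>Q n\<close> describes
    the \<open>n\<close>-th step.\<close>
  define P where "P s \<longleftrightarrow> continuous_map X euclideanreal s \<and> (\<forall>y\<in>topspace X. 0 \<le> s y) \<and> s z = 0" for s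
  define Q where "Q n s s' \<longleftrightarrow> (\<forall>y\<in>topspace X. s y \<le> s' y \<and> s' y \<le> s y + (1/2)^n)
      \<and> (\<exists>x\<in>topspace X. s x < (1/2)^n \<and> 0 < s' x)" for n :: nat and s s' :: "'a \<Rightarrow> real"
  have step: "\<exists>s'. P s' \<and> Q n s s'" if s: "P s" for n s
  proof -
    have "openin X {y \<in> topspace X. s y \<in> {..<(1/2)^n}}"
      using s by (intro openin_continuous_map_preimage[where Y = euclideanreal]) (auto simp: P_def)
    then obtain x where x: "x \<in> topspace X" "x \<noteq> z" "s x < (1/2)^n"
      using accum z s by (force simp: P_def)
    then obtain f where f: "continuous_map X euclideanreal f"
      "\<And>y. y \<in> topspace X \<Longrightarrow> 0 \<le> f y \<and> f y \<le> 1" "f z = 0" "f x = 1"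
      using bump by blast
    define s' where "s' y = s y + (1/2)^n * f y" for y
    have "continuous_map X euclideanreal s'"
      unfolding s'_def using s f(1) by (auto simp: P_def intro!: continuous_intros)
    then have "P s'" using s f by (auto simp: P_def s'_def)
    moreover have "Q n s s'"
    proof -
      have "0 < s' x" using s x f(4) by (auto simp: P_def s'_def intro: add_nonneg_pos)
      then show ?thesis
        unfolding Q_def using x f(2) by (auto simp: s'_def mult_left_le)
    qed
    ultimately show ?thesis by blast
  qed
  have "P (\<lambda>_. 0)" by (simp add: P_def)
  then obtain s where s: "\<And>n. P (s n)" "\<And>n. Q n (s n) (s (Suc n))"
    using dependent_nat_choice[of "\<lambda>n. P" Q] step by metis
  have mono: "s m y \<le> s n y" and bound: "s n y \<le> s m y + 2 * (1/2)^m - 2 * (1/2)^n"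
    if "m \<le> n" "y \<in> topspace X" for m n y
  proof -
    have sy: "s k y \<le> s (Suc k) y" "s (Suc k) y \<le> s k y + (1/2)^k" for k
      using s(2)[of k] that(2) by (auto simp: Q_def)
    show "s m y \<le> s n y"
      by (rule lift_Suc_mono_le[of "\<lambda>n. s n y", OF sy(1) that(1)])
    show "s n y \<le> s m y + 2 * (1/2)^m - 2 * (1/2)^n"
      using that(1)
    proof (induction rule: dec_induct)
      case (step k)
      then show ?case using sy(2)[of k] by simp
    qed simp
  qed
  define F where "F y = lim (\<lambda>n. s n y)" for y
  have lim: "(\<lambda>n. s n y) \<longlonglongrightarrow> F y" if "y \<in> topspace X" for y
  proof -
    have "s n y \<le> s 0 y + 2" for n
    proof -
      have "0 \<le> (1/2 :: real) ^ n" by simp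
      moreover have "s n y \<le> s 0 y + 2 - 2 * (1/2) ^ n" using bound[of 0 n y] that by simp
      ultimately show ?thesis by linarith
    qed
    moreover have "incseq (\<lambda>n. s n y)"
      using mono that by (auto simp: incseq_def)
    ultimately have "convergent (\<lambda>n. s n y)"
      using incseq_convergent by (metis convergentI)
    then show ?thesis by (simp add: F_def convergent_LIMSEQ_iff)
  qed
  have F: "s m y \<le> F y" "F y \<le> s m y + 2 * (1/2)^m" if "y \<in> topspace X" for m y
  proof -
    show "s m y \<le> F y"
      using mono that by (intro LIMSEQ_le_const[OF lim[OF that]]) blast
    have "s n y \<le> s m y + 2 * (1/2)^m" if "m \<le> n" for n
    proof -
      have "0 \<le> (1/2 :: real) ^ n" by simp
      then show ?thesis using bound[OF that \<open>y \<in> topspace X\<close>] by linarith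
    qed
    then show "F y \<le> s m y + 2 * (1/2)^m"
      by (intro LIMSEQ_le_const2[OF lim[OF that]]) blast
  qed
  have cont: "continuous_map X euclideanreal F"
  proof -
    have "continuous_map X Met_TC.mtopology F"
    proof (rule Met_TC.continuous_map_uniform_limit[where F = sequentially and f = s])
      show "\<forall>\<^sub>F n in sequentially. continuous_map X Met_TC.mtopology (s n)"
        using s(1) by (simp add: P_def)
      fix e :: real assume "0 < e"
      have "(\<lambda>n. 2 * (1/2)^n :: real) \<longlonglongrightarrow> 2 * 0"
        by (intro tendsto_intros LIMSEQ_realpow_zero) auto
      then have "\<forall>\<^sub>F n in sequentially. 2 * (1/2)^n < e"
        by (rule order_tendstoD(2)) (use \<open>0 < e\<close> in simp)
      then show "\<forall>\<^sub>F n in sequentially. \<forall>x\<in>topspace X. F x \<in> UNIV \<and> dist (s n x) (F x) < e"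
      proof (rule eventually_mono, intro ballI conjI)
        fix n x assume "2 * (1/2)^n < e" "x \<in> topspace X"
        then show "dist (s n x) (F x) < e"
          using F[of x n] by (simp add: dist_real_def)
      qed simp
    qed simp
    then show ?thesis by simp
  qed
  have small: "\<exists>x\<in>topspace X. 0 < F x \<and> F x < e" if "0 < e" for e
  proof -
    obtain n where n: "(1/2)^n < e / 3"
      using real_arch_pow_inv[of "e/3" "1/2"] \<open>0 < e\<close> by fastforce
    obtain x where x: "x \<in> topspace X" "s n x < (1/2)^n" "0 < s (Suc n) x"
      using s(2)[of n] by (auto simp: Q_def)
    have "0 < F x" using F(1)[OF x(1), of "Suc n"] x(3) by linarith
    moreover have "F x < e" using F(2)[OF x(1), of n] x(2) n by linarith
    ultimately show ?thesis using x(1) by blast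
  qed
  have "infinite (F ` topspace X)"
  proof
    assume fin: "finite (F ` topspace X)"
    define I where "I = F ` topspace X \<inter> {0<..}"
    have "finite I" "I \<noteq> {}" using fin small[of 1] by (auto simp: I_def)
    \<comment> \<open>A finite range would have a least positive element.\<close>
    then have "0 < Min I" "\<And>x. x \<in> I \<Longrightarrow> Min I \<le> x" by (auto simp: I_def)
    then show False using small[of "Min I"] by (force simp: I_def)
  qed
  moreover have "F x \<ge> 0" if "x \<in> topspace X" for x
    using F(1)[OF that, of 0] s(1)[of 0] that by (auto simp: P_def)
  ultimately show thesis using that cont by blast
qed

text \<open>The functions \<open>1 / (F + t)\<close> for distinct \<open>t > 0\<close> are linearly independent: clearing
  denominators in a linear relation between them yields a polynomial in \<open>F\<close> which vanishes at the
  infinitely many values of \<open>F\<close>, hence everywhere; evaluating it at \<open>-t\<close> isolates the coefficient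
  of \<open>1 / (F + t)\<close>.\<close>

lemma coeff_eq_0_of_sum_reciprocals_eq_0:
  fixes F :: "'a \<Rightarrow> real" and u :: "real \<Rightarrow> 'k::real_normed_field"
  assumes inf: "infinite (F ` A)" and nonneg: "\<And>x. x \<in> A \<Longrightarrow> F x \<ge> 0"
    and T: "finite T" "T \<subseteq> {0<..}"
    and sum: "\<And>x. x \<in> A \<Longrightarrow> (\<Sum>t\<in>T. u t * of_real (1 / (F x + t))) = 0"
    and t: "t \<in> T"
  shows "u t = 0"
proof -
  define p where "p = (\<Sum>t\<in>T. smult (u t) (\<Prod>r\<in>T - {t}. [:of_real r, 1:]))"
  have "poly p (of_real (F x)) = 0" if x: "x \<in> A" for x
  proof -
    have pos: "F x + r \<noteq> 0" if "r \<in> T" for r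
      using nonneg[OF x] T(2) that by (force simp: add_nonneg_pos)
    have "poly p (of_real (F x)) = (\<Sum>t\<in>T. u t * (\<Prod>r\<in>T - {t}. of_real (F x + r)))"
      by (simp add: p_def poly_sum poly_prod add.commute)
    also have "\<dots> = (\<Sum>t\<in>T. (\<Prod>r\<in>T. of_real (F x + r)) * (u t * of_real (1 / (F x + t))))"
      by (intro sum.cong refl) (use pos in \<open>auto simp: prod.remove[OF T(1)] of_real_divide simp del: of_real_add\<close>)
    also have "\<dots> = (\<Prod>r\<in>T. of_real (F x + r)) * (\<Sum>t\<in>T. u t * of_real (1 / (F x + t)))"
      by (simp add: sum_distrib_left)
    finally show ?thesis using sum[OF x] by simp
  qed
  then have "(of_real :: real \<Rightarrow> 'k) ` F ` A \<subseteq> {y. poly p y = 0}" by auto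
  moreover have "infinite ((of_real :: real \<Rightarrow> 'k) ` F ` A)"
    using inf by (simp add: finite_image_iff inj_on_def)
  ultimately have "p = 0"
    using poly_roots_finite finite_subset by blast
  then have "0 = poly p (- of_real t)" by simp
  also have "\<dots> = (\<Sum>r\<in>T. u r * (\<Prod>q\<in>T - {r}. of_real q - of_real t))"
    by (simp add: p_def poly_sum poly_prod)
  also have "\<dots> = u t * (\<Prod>q\<in>T - {t}. of_real q - of_real t) +
      (\<Sum>r\<in>T - {t}. u r * (\<Prod>q\<in>T - {r}. of_real q - of_real t))"
    using T(1) t by (rule sum.remove)
  also have "(\<Sum>r\<in>T - {t}. u r * (\<Prod>q\<in>T - {r}. of_real q - of_real t)) = 0"
    using T(1) t by (intro sum.neutral ballI) (auto intro!: prod_zero)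
  finally have "u t * (\<Prod>q\<in>T - {t}. of_real q - of_real t) = 0" by simp
  moreover have "(\<Prod>q\<in>T - {t}. of_real q - of_real t :: 'k) \<noteq> 0"
    using T(1) by (simp add: prod_zero_iff)
  ultimately show ?thesis by simp
qed

text \<open>The family \<open>1 / (F + t)\<close>, for \<open>F \<ge> 0\<close> of infinite range, consists of continuum many
  independent functions. The bound ensures that \<^const>\<open>sw\<close> absorbs the cardinality of
  the scalar field.\<close>

lemma continuum_ordLeq_sw:
  fixes X :: "'a topology" and K :: "'k::real_normed_field itself"
  assumes X: "compact_space X" "Hausdorff_space X" "infinite (topspace X)"
  shows "|UNIV :: real set| \<le>o sw K X"
proof -
  obtain F where F: "continuous_map X euclideanreal F" "\<And>x. x \<in> topspace X \<Longrightarrow> F x \<ge> 0"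
    "infinite (F ` topspace X)"
    by (rule ex_continuous_map_infinite_range[OF X]) blast
  define e :: "real \<Rightarrow> 'a \<Rightarrow> 'k"
    where "e t x = (if x \<in> topspace X then of_real (1 / (F x + t)) else 0)" for t x
  define P where "P = {0::real<..}"
  have indep: "u t = 0" if "finite T" "T \<subseteq> P" "\<And>x. x \<in> topspace X \<Longrightarrow> (\<Sum>t\<in>T. u t * e t x) = 0" "t \<in> T"
    for T u t
  proof (rule coeff_eq_0_of_sum_reciprocals_eq_0[OF F(3,2) that(1)])
    show "(\<Sum>t\<in>T. u t * of_real (1 / (F x + t))) = 0" if "x \<in> topspace X" for x
      using \<open>\<And>x. x \<in> topspace X \<Longrightarrow> (\<Sum>t\<in>T. u t * e t x) = 0\<close>[OF that] that by (simp add: e_def)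
  qed (use that in \<open>auto simp: P_def\<close>)
  have inj: "inj_on e P"
  proof (rule inj_onI, rule ccontr)
    fix r t assume rt: "r \<in> P" "t \<in> P" "e r = e t" "r \<noteq> t"
    \<comment> \<open>Otherwise \<open>e r - e t = 0\<close> would be a nontrivial relation.\<close>
    then have "(if r = r then 1 else - 1 :: 'k) = 0"
      by (intro indep[of "{r,t}" "\<lambda>q. if q = r then 1 else - 1" r]) auto
    then show False by simp
  qed
  have "fun_space.independent (e ` P)"
    unfolding fun_space.independent_explicit_finite_subsets
  proof (intro allI impI ballI)
    fix S u v assume S: "S \<subseteq> e ` P" "finite S" and sum0: "(\<Sum>v\<in>S. (\<lambda>x. u v * v x)) = 0" and "v \<in> S"
    obtain T where T: "T \<subseteq> P" "S = e ` T" "finite T"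
      using S by (metis finite_subset_image)
    obtain t where t: "t \<in> T" "v = e t" using \<open>v \<in> S\<close> T(2) by blast
    have injT: "inj_on e T" using inj T(1) inj_on_subset by blast
    have "(\<Sum>t\<in>T. u (e t) * e t x) = 0" for x
    proof -
      have "(\<Sum>t\<in>T. u (e t) * e t x) = (\<Sum>v\<in>S. u v * v x)"
        unfolding T(2) sum.reindex[OF injT] by simp
      also have "\<dots> = (\<Sum>v\<in>S. (\<lambda>x. u v * v x)) x"
        using S(2) by (induction S) simp_all
      finally show ?thesis by (simp add: sum0)
    qed
    then show "u v = 0"
      using indep[OF T(3,1), of "u \<circ> e" t] t by simp
  qed
  moreover have "e t \<in> cfun K X" if t: "t \<in> P" for t
  proof -
    have pos: "F x + t \<noteq> 0" if "x \<in> topspace X" for x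
      using F(2)[OF that] t by (auto simp: P_def)
    have "continuous_map X euclideanreal (\<lambda>x. 1 / (F x + t))"
      using F(1) pos by (intro continuous_map_real_divide continuous_intros) auto
    moreover have "continuous_map euclideanreal euclidean (of_real :: real \<Rightarrow> 'k)"
      by (auto intro!: continuous_intros)
    ultimately have "continuous_map X euclidean ((of_real :: real \<Rightarrow> 'k) \<circ> (\<lambda>x. 1 / (F x + t)))"
      by (rule continuous_map_compose)
    then have "continuous_map X euclidean (e t)"
      by (rule continuous_map_eq) (simp add: e_def)
    then show ?thesis by (simp add: cfun_def e_def)
  qed
  ultimately have "|e ` P| \<le>o sw K X"
    unfolding sw_def using subspace_cfun by (intro independent_ordLeq_cdim) auto
  moreover have "|e ` P| =o |P|"
    using inj inj_on_imp_bij_betw card_of_ordIso ordIso_symmetric by metis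
  moreover have "|UNIV :: real set| =o |P|"
  proof -
    have "P \<subseteq> range exp"
      unfolding P_def by (metis exp_ln greaterThan_iff range_eqI subsetI)
    then have "bij_betw exp (UNIV :: real set) P"
      unfolding P_def bij_betw_def by (auto simp: inj_on_def)
    then show ?thesis using card_of_ordIso by blast
  qed
  ultimately show ?thesis
    using ordIso_ordLeq_trans ordIso_symmetric by metis
qed

section \<open>The image of the difference operator\<close>

lemma linear_map_Delta: "linear_map (Delta \<rho> :: ('a \<Rightarrow> 'k::real_normed_field) \<Rightarrow> _)"
  by (rule linear_mapI) (auto simp: Delta_def fun_eq_iff algebra_simps)

lemma linear_map_restrict0: "linear_map (restrict0 A :: ('a \<Rightarrow> 'k::field) \<Rightarrow> _)"
  by (rule linear_mapI) (auto simp: restrict0_def fun_eq_iff)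

lemma ordIso_of_csum_ordLess:
  fixes a :: "'x rel" and b :: "'y rel" and c :: "'z rel"
  assumes "Cinfinite a" and "Card_order b" and "Card_order c" and "a =o b +c c" and "c <o a"
  shows "b =o a"
proof -
  have "b \<le>o a"
    using ordLeq_csum1[OF assms(2)] ordIso_symmetric[OF assms(4)] by (rule ordLeq_ordIso_trans)
  moreover have "\<not> b <o a"
  proof
    assume "b <o a"
    then have "b +c c <o a"
      unfolding csum_def using assms
      by (intro card_of_Plus_ordLess_infinite_Field ordIso_ordLess_trans[OF card_of_Field_ordIso])
        (auto simp: cinfinite_def)
    then have "a <o a" using assms(4) ordIso_ordLess_trans by blast
    then show False using ordLess_irreflexive by blast
  qed
  ultimately show ?thesis using ordLeq_iff_ordLess_or_ordIso by blast
qed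

lemma representatives_eq:
  assumes "equiv (topspace L) \<rho>" and "representatives L \<rho> R" and "y \<in> R" "y' \<in> R" "(y, y') \<in> \<rho>"
  shows "y = y'"
proof -
  have "y \<in> topspace L" using assms(2,3) by (auto simp: representatives_def)
  then have "\<rho> `` {y} \<in> topspace L // \<rho>" and "(y, y) \<in> \<rho>"
    using assms(1) by (auto simp: quotientI equiv_def refl_on_def)
  then show ?thesis
    using assms(2-5) by (auto simp: representatives_def)
qed

text \<open>The heart of the proof: on \<open>S\<close>, the only constraint on a function of the form
  \<open>f x - f y\<close> is that it vanishes on the diagonal. Since second coordinates of points of \<open>S\<close> are
  representatives, a point \<open>(x, y)\<close> of \<open>S\<close> is determined by \<open>x\<close>. Given \<open>h\<close> one can therefore try to
  prescribe \<open>f x = h (x, y)\<close> on the first projection of \<open>S\<close> and \<open>f y = 0\<close> on the second. The two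
  prescriptions meet only at points with \<open>(x, x) \<in> S\<close>, where \<open>h\<close> vanishes, so they agree; both
  projections are closed by compactness, and Tietze's theorem extends \<open>f\<close> to \<open>L\<close>.\<close>

lemma restrict0_im_Delta:
  fixes L :: "'a topology" and K :: "'k::{real_normed_field,euclidean_space} itself"
  assumes L: "compact_space L" "Hausdorff_space L"
    and \<rho>: "equiv (topspace L) \<rho>" and R: "representatives L \<rho> R"
    and S: "S \<subseteq> (topspace L \<times> R) \<inter> \<rho>" "closedin (prod_topology L L) S"
  shows "restrict0 S ` im_Delta K L \<rho> =
    {h \<in> cfun K (subtopology (prod_topology L L) S). \<forall>p\<in>S \<inter> Id_on (topspace L). h p = 0}"
    (is "_ = ?H")
proof
  have \<rho>_sub: "\<rho> \<subseteq> topspace L \<times> topspace L"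
    using \<rho> by (auto simp: equiv_def refl_on_def)
  show "restrict0 S ` im_Delta K L \<rho> \<subseteq> ?H"
  proof
    fix h assume "h \<in> restrict0 S ` im_Delta K L \<rho>"
    then obtain f where f: "f \<in> cfun K L" "h = restrict0 S (Delta \<rho> f)"
      by (auto simp: im_Delta_def)
    then have "Delta \<rho> f \<in> cfun K (subtopology (prod_topology L L) \<rho>)"
      using im_Delta_subset_cfun[OF \<rho>_sub, of K] by (auto simp: im_Delta_def)
    then have "h \<in> cfun K (subtopology (subtopology (prod_topology L L) \<rho>) S)"
      unfolding f(2) using S(1) \<rho>_sub by (intro restrict0_in_cfun) (auto simp: cfun_def)
    moreover have "subtopology (subtopology (prod_topology L L) \<rho>) S = subtopology (prod_topology L L) S"
      using S(1) by (simp add: subtopology_subtopology Int_absorb1)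
    moreover have "h p = 0" if "p \<in> S \<inter> Id_on (topspace L)" for p
      using that by (auto simp: f(2) restrict0_def Delta_def)
    ultimately show "h \<in> ?H" by simp
  qed
  show "?H \<subseteq> restrict0 S ` im_Delta K L \<rho>"
  proof
    fix h assume h: "h \<in> ?H"
    let ?X = "subtopology (prod_topology L L) S"
    have topX: "topspace ?X = S"
      using closedin_subset[OF S(2)] by (simp add: Int_absorb1)
    have unique: "y = y'" if "(x, y) \<in> S" "(x, y') \<in> S" for x y y'
    proof -
      have "(y, x) \<in> \<rho>" "(x, y') \<in> \<rho>"
        using that S(1) \<rho> by (auto simp: equiv_def dest: symD)
      then have "(y, y') \<in> \<rho>"
        using \<rho> by (auto simp: equiv_def dest: transD)
      then show ?thesis
        using that S(1) by (intro representatives_eq[OF \<rho> R]) auto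
    qed
    have fixed: "x = y" if "(x, y) \<in> S" "x \<in> R" for x y
      using that S(1) by (intro representatives_eq[OF \<rho> R]) auto
    define g where "g x = (if x \<in> fst ` S then h (x, THE y. (x, y) \<in> S) else 0)" for x
    have g_fst: "g x = h (x, y)" if "(x, y) \<in> S" for x y
    proof -
      have "(THE y. (x, y) \<in> S) = y" using that unique by blast
      then show ?thesis using that by (force simp: g_def)
    qed
    have g_snd: "g y = 0" if xy: "(x, y) \<in> S" for x y
    proof (cases "y \<in> fst ` S")
      case True
      then obtain z where z: "(y, z) \<in> S" by force
      have "y \<in> R" using xy S(1) by auto
      then have "z = y" using fixed[OF z] by simp
      then have "(y, y) \<in> S \<inter> Id_on (topspace L)" using z S(1) by auto
      then show ?thesis using g_fst[of y y] h by auto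
    qed (simp add: g_def)
    define C where "C = fst ` S \<union> snd ` S"
    have "compact_space ?X"
      using L(1) S(2) by (simp add: closedin_compact_space compact_space_prod_topology compact_space_subtopology)
    then have closed_proj: "closed_map ?X L fst" "closed_map ?X L snd"
      using L(2) by (auto intro!: continuous_imp_closed_map continuous_map_from_subtopology
          continuous_map_fst continuous_map_snd)
    then have closed_snd: "closedin L (snd ` S)" and closed_fst: "closedin L (fst ` S)"
      using topX unfolding closed_map_def by (metis closedin_topspace)+
    then have C: "closedin L C" unfolding C_def by (intro closedin_Un)
    \<comment> \<open>Preimages of closed sets under \<open>g\<close> are projections of closed subsets of \<open>S\<close>.
      This avoids inverting the first projection.\<close>
    have "continuous_map (subtopology L C) euclidean g"
      unfolding continuous_map_closedin
    proof (intro conjI allI impI)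
      fix U :: "'k set" assume U: "closedin euclidean U"
      have "closedin ?X {p \<in> topspace ?X. h p \<in> U}"
        using h U by (intro closedin_continuous_map_preimage) (auto simp: cfun_def)
      then have "closedin L (fst ` {p \<in> S. h p \<in> U})"
        using closed_proj(1) unfolding closed_map_def topX by blast
      moreover have "{x \<in> C. g x \<in> U} =
          fst ` {p \<in> S. h p \<in> U} \<union> (if 0 \<in> U then snd ` S else {})"
      proof (intro equalityI subsetI)
        fix x assume "x \<in> {x \<in> C. g x \<in> U}"
        then have x: "x \<in> C" "g x \<in> U" by auto
        from x(1) consider y where "(x, y) \<in> S" | y where "(y, x) \<in> S"
          by (force simp: C_def)
        then show "x \<in> fst ` {p \<in> S. h p \<in> U} \<union> (if 0 \<in> U then snd ` S else {})"
        proof cases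
          case 1
          then have "(x, y) \<in> {p \<in> S. h p \<in> U}" using x(2) g_fst by simp
          then show ?thesis by force
        next
          case 2
          then have "0 \<in> U" using x(2) g_snd by metis
          then show ?thesis using 2 by force
        qed
      next
        fix x assume "x \<in> fst ` {p \<in> S. h p \<in> U} \<union> (if 0 \<in> U then snd ` S else {})"
        then consider y where "(x, y) \<in> S" "h (x, y) \<in> U" | y where "(y, x) \<in> S" "0 \<in> U"
          by (auto split: if_splits)
        then show "x \<in> {x \<in> C. g x \<in> U}"
          by cases (use g_fst g_snd in \<open>force simp: C_def\<close>)+
      qed
      ultimately have "closedin L {x \<in> C. g x \<in> U}"
        using closed_snd by (simp add: closedin_Un)
      moreover have "topspace (subtopology L C) = C"
        using closedin_subset[OF C] by (simp add: Int_absorb1)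
      ultimately show "closedin (subtopology L C) {x \<in> topspace (subtopology L C). g x \<in> U}"
        using C by (auto simp: closedin_closed_subtopology)
    qed auto
    then have "g \<in> cfun K (subtopology L C)"
      using closedin_subset[OF C] by (auto simp: cfun_def g_def C_def)
    then obtain f where f: "f \<in> cfun K L" "g = restrict0 C f"
      using restrict0_cfun[OF compact_Hausdorff_or_regular_imp_normal_space C, of K] L by blast
    have "restrict0 S (Delta \<rho> f) p = h p" for p
    proof (cases "p \<in> S")
      case True
      obtain x y where p: "p = (x, y)" by force
      have "x \<in> C" "y \<in> C" "(x, y) \<in> \<rho>" using True S(1) by (force simp: p C_def)+
      then have "restrict0 S (Delta \<rho> f) p = g x - g y"
        using True by (simp add: p f(2) restrict0_def Delta_def)
      then show ?thesis using g_fst g_snd True p by simp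
    next
      case False
      then have "h p = 0" using h unfolding cfun_def topX by blast
      then show ?thesis using False by (simp add: restrict0_def)
    qed
    then have "h = restrict0 S (Delta \<rho> f)" by auto
    then show "h \<in> restrict0 S ` im_Delta K L \<rho>"
      using f(1) by (auto simp: im_Delta_def)
  qed
qed

text \<open>Restricting the image of \<^const>\<open>Delta\<close> to \<open>S\<close> has a kernel \<open>N\<close> of cardinality
  \<open>\<kappa>\<^sub>0\<close>, and its image is the kernel of the restriction map from \<open>S\<close> to its diagonal part, which has
  dimension \<^term>\<open>sw K (subtopology (prod_topology L L) S)\<close> because the diagonal part contributes
  strictly less. So the dimension in question is that of \<open>N\<close> plus \<^const>\<open>sw\<close> of \<open>S\<close>. The dimension of \<open>N\<close> may
  differ from its cardinality, for instance when \<open>N\<close> is finite-dimensional, but only by as much as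
  the cardinality of the scalar field, and that is absorbed by the other summand.\<close>

lemma cdim_im_Delta:
  fixes L :: "'a topology" and K :: "'k::{real_normed_field,euclidean_space} itself"
  assumes scalars: "|UNIV :: 'k set| \<le>o |UNIV :: real set|"
    and L: "compact_space L" "Hausdorff_space L"
    and \<rho>: "equiv (topspace L) \<rho>" and R: "representatives L \<rho> R"
    and S: "S \<subseteq> (topspace L \<times> R) \<inter> \<rho>" "closedin (prod_topology L L) S" "infinite S"
    and diag: "sw K (subtopology (prod_topology L L) (S \<inter> Id_on (topspace L)))
        <o sw K (subtopology (prod_topology L L) S)"
  shows "cdim (im_Delta K L \<rho>) =o
    sw K (subtopology (prod_topology L L) S) +c |{f \<in> im_Delta K L \<rho>. \<forall>p\<in>S. f p = 0}|"
proof -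
  let ?P = "prod_topology L L" and ?I = "im_Delta K L \<rho>"
  let ?X = "subtopology ?P S" and ?D = "S \<inter> Id_on (topspace L)"
  define N where "N = {f \<in> ?I. \<forall>p\<in>S. f p = 0}"
  have P: "compact_space ?P" "Hausdorff_space ?P"
    using L by (simp_all add: compact_space_prod_topology Hausdorff_space_prod_topology)
  have X: "compact_space ?X" "Hausdorff_space ?X"
    using P S(2) by (simp_all add: closedin_compact_space compact_space_subtopology Hausdorff_space_subtopology)
  have topX: "topspace ?X = S"
    using closedin_subset[OF S(2)] by (simp add: Int_absorb1)
  have sw: "|UNIV :: real set| \<le>o sw K ?X"
    using continuum_ordLeq_sw[OF X] S(3) topX by simp
  have Card_sw: "Card_order (sw K ?X)"
    unfolding sw_def by (rule Card_order_cdim)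
  have inf_sw: "Cinfinite (sw K ?X)"
  proof -
    have "cinfinite |UNIV :: real set|"
      by (simp add: cinfinite_def Field_card_of infinite_UNIV_char_0)
    then show ?thesis using cinfinite_mono[OF sw] Card_sw by blast
  qed
  have subI: "fun_space.subspace ?I"
    unfolding im_Delta_def by (rule subspace_linear_image[OF linear_map_Delta subspace_cfun])

  have e: "cdim (restrict0 S ` ?I) =o sw K ?X"
  proof (rule ordIso_of_csum_ordLess[OF inf_sw Card_order_cdim Card_order_cdim _ diag[unfolded sw_def[of K "subtopology ?P ?D"]]])
    have "Id_on (topspace L) = (\<lambda>x. (x, x)) ` topspace L" by auto
    then have "closedin ?P (Id_on (topspace L))"
      using L(2) by (simp add: Hausdorff_space_closedin_diagonal)
    then have D: "closedin ?X ?D"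
      using S(2) by (simp add: closedin_closed_subtopology closedin_Int)
    have "restrict0 ?D ` cfun K ?X = cfun K (subtopology ?X ?D)"
      using X compact_Hausdorff_or_regular_imp_normal_space by (intro restrict0_cfun D) blast
    also have "subtopology ?X ?D = subtopology ?P ?D"
      by (simp add: subtopology_subtopology)
    finally have image: "restrict0 ?D ` cfun K ?X = cfun K (subtopology ?P ?D)" .
    have kernel: "{h \<in> cfun K ?X. restrict0 ?D h = 0} = restrict0 S ` ?I"
      unfolding restrict0_im_Delta[OF L \<rho> R S(1,2)] restrict0_eq_0_iff ..
    show "sw K ?X =o cdim (restrict0 S ` ?I) +c cdim (cfun K (subtopology ?P ?D))"
      using rank_nullity[OF linear_map_restrict0[of ?D] subspace_cfun[of K ?X]]
      unfolding image kernel sw_def .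
  qed

  have "{f \<in> ?I. restrict0 S f = 0} = N"
    by (simp add: N_def restrict0_eq_0_iff)
  then have "cdim ?I =o cdim N +c cdim (restrict0 S ` ?I)"
    using rank_nullity[OF linear_map_restrict0[of S] subI] by simp
  also have "cdim N +c cdim (restrict0 S ` ?I) =o cdim N +c sw K ?X"
    using e by (rule csum_cong2)
  also have "cdim N +c sw K ?X =o sw K ?X +c |N|"
  proof -
    have subN: "fun_space.subspace N"
      using subI by (auto simp: N_def fun_space.subspace_def)
    define r where "r = cdim N +c sw K ?X"
    have r: "Cinfinite r"
      unfolding r_def using Cinfinite_csum inf_sw by blast
    have dim_r: "cdim N \<le>o r" and sw_r: "sw K ?X \<le>o r"
      unfolding r_def by (rule ordLeq_csum1 ordLeq_csum2, rule Card_order_cdim Card_sw)+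
    have "|UNIV :: 'k set| \<le>o r"
      using ordLeq_transitive[OF scalars ordLeq_transitive[OF sw sw_r]] .
    then have "|N| \<le>o r"
      by (rule card_of_subspace_ordLeq[OF subN r dim_r])
    then have "sw K ?X +c |N| \<le>o r"
      using sw_r Card_sw r by (intro csum_cinfinite_bound card_of_Card_order) 
    moreover have "r \<le>o sw K ?X +c |N|"
    proof -
      have "r \<le>o |N| +c sw K ?X"
        unfolding r_def by (rule csum_mono1[OF cdim_ordLeq_card_of[OF subN]])
      then show ?thesis using csum_com by (rule ordLeq_ordIso_trans)
    qed
    ultimately show ?thesis
      unfolding r_def ordIso_iff_ordLeq by blast
  qed
  finally show ?thesis unfolding N_def .
qed

lemma lineable_complement_of_ker_Delta:
  fixes L :: "'a topology" and K :: "'k::{real_normed_field,euclidean_space} itself"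
  assumes scalars: "|UNIV :: 'k set| \<le>o |UNIV :: real set|"
    and L: "compact_space L" "Hausdorff_space L"
    and \<rho>: "equiv (topspace L) \<rho>" and R: "representatives L \<rho> R"
    and S: "S \<subseteq> (topspace L \<times> R) \<inter> \<rho>" "closedin (prod_topology L L) S" "infinite S"
    and diag: "sw K (subtopology (prod_topology L L) (S \<inter> Id_on (topspace L)))
        <o sw K (subtopology (prod_topology L L) S)"
  shows "let \<kappa>\<^sub>0 = |{f \<in> im_Delta K L \<rho>. \<forall>p\<in>S. f p = 0}|;
           \<kappa> = sw K (subtopology (prod_topology L L) S) +c \<kappa>\<^sub>0;
           M = cfun K L - ker_Delta K L \<rho>
       in lineable M \<kappa> \<and> \<not> lineable M (cardSuc \<kappa>)"
  using lineable_complement_of_kernel[OF linear_map_Delta subspace_cfun Card_order_csum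
      cdim_im_Delta[OF assms, unfolded im_Delta_def]]
  unfolding Let_def ker_Delta_def im_Delta_def by blast

lemma complex_ordLeq_real: "|UNIV :: complex set| \<le>o |UNIV :: real set|"
proof -
  have "inj (\<lambda>z. (Re z, Im z))" by (auto simp: inj_def complex_eq_iff)
  then have "|UNIV :: complex set| \<le>o |(UNIV :: real set) \<times> (UNIV :: real set)|"
    using card_of_ordLeq by fastforce
  also have "|(UNIV :: real set) \<times> (UNIV :: real set)| =o |UNIV :: real set|"
    by (rule card_of_Times_same_infinite) (rule infinite_UNIV_char_0)
  finally show ?thesis .
qed

theorem proposition3p11:
  fixes L :: "'a topology" and \<rho> S :: "('a \<times> 'a) set" and R :: "'a set"
  assumes "compact_space L" and "Hausdorff_space L"
    and "equiv (topspace L) \<rho>" and "closedin (prod_topology L L) \<rho>"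
    and "representatives L \<rho> R"
    and "S \<subseteq> (topspace L \<times> R) \<inter> \<rho>" and "closedin (prod_topology L L) S" and "infinite S"
  shows
    "(sw TYPE(real) (subtopology (prod_topology L L) (S \<inter> Id_on (topspace L)))
        <o sw TYPE(real) (subtopology (prod_topology L L) S) \<longrightarrow>
      (let \<kappa>\<^sub>0 = |{f \<in> im_Delta TYPE(real) L \<rho>. \<forall>p\<in>S. f p = 0}|;
           \<kappa> = sw TYPE(real) (subtopology (prod_topology L L) S) +c \<kappa>\<^sub>0;
           M = cfun TYPE(real) L - ker_Delta TYPE(real) L \<rho>
       in lineable M \<kappa> \<and> \<not> lineable M (cardSuc \<kappa>)))
   \<and> (sw TYPE(complex) (subtopology (prod_topology L L) (S \<inter> Id_on (topspace L)))
        <o sw TYPE(complex) (subtopology (prod_topology L L) S) \<longrightarrow>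
      (let \<kappa>\<^sub>0 = |{f \<in> im_Delta TYPE(complex) L \<rho>. \<forall>p\<in>S. f p = 0}|;
           \<kappa> = sw TYPE(complex) (subtopology (prod_topology L L) S) +c \<kappa>\<^sub>0;
           M = cfun TYPE(complex) L - ker_Delta TYPE(complex) L \<rho>
       in lineable M \<kappa> \<and> \<not> lineable M (cardSuc \<kappa>)))"
  by (intro conjI impI lineable_complement_of_ker_Delta[OF _ assms(1,2,3,5,6,7,8)]
      card_of_refl complex_ordLeq_real ordIso_imp_ordLeq)

end
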